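(* Let $\mu>0$ and let $F$ be a differentiable (positive) function on the general convex set $K_g$. Then $F$ is a strongly exponentially general convex function (with constant $\mu$) if and only if $$e^{F(g(v))}-e^{F(g(u))}\ge\langle e^{F(g(u))}F'(g(u)),\,g(v)-g(u)\rangle+\mu\,\|g(v)-g(u)\|^2\qquad\text{for all } g(u),g(v)\in K_g .$$
   Context: $H$ is a real Hilbert space with inner product $\langle\cdot,\cdot\rangle$ and norm $\|\cdot\|$, and $g:H\to H$ is an arbitrary function. $K_g\subseteq H$ is a general convex set with respect to $g$: $g(u)+t(g(v)-g(u))\in K_g$ for all $u,v\in H$ with $g(u),g(v)\in K_g$ and all $t\in[0,1]$. As a standing assumption $g$ is onto $K_g$ (every point of $K_g$ is $g(v)$ for some $v\in H$). "For all $g(u),g(v)\in K_g$" means for all $u,v\in H$ with $g(u),g(v)\in K_g$. A positive real-valued function $F$ on $K_g$ is strongly exponentially general convex with constant $\mu>0$ if $$e^{F(g(u)+t(g(v)-g(u)))}\le(1-t)e^{F(g(u))}+te^{F(g(v))}-\mu\,t(1-t)\,\|g(v)-g(u)\|^2$$ for all $g(u),g(v)\in K_g$ and $t\in[0,1]$. "Differentiable" means Fréchet differentiable at the points of $K_g$ ($F$ being understood as defined near $K_g$), with $F'$ identified with an element of $H$. *)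

theory Defs
  imports "HOL-Analysis.Analysis"
begin

definition general_convex :: "('a::real_vector \<Rightarrow> 'a) \<Rightarrow> 'a set \<Rightarrow> bool" where
  "general_convex g K \<longleftrightarrow>
     (\<forall>u v. \<forall>t\<in>{0..1}. g u \<in> K \<longrightarrow> g v \<in> K \<longrightarrow> g u + t *\<^sub>R (g v - g u) \<in> K)"

definition strongly_exp_general_convex ::
    "real \<Rightarrow> ('a::real_normed_vector \<Rightarrow> 'a) \<Rightarrow> 'a set \<Rightarrow> ('a \<Rightarrow> real) \<Rightarrow> bool" where
  "strongly_exp_general_convex \<mu> g K F \<longleftrightarrow>
     (\<forall>u v. \<forall>t\<in>{0..1}. g u \<in> K \<longrightarrow> g v \<in> K \<longrightarrow>
        exp (F (g u + t *\<^sub>R (g v - g u)))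
          \<le> (1 - t) * exp (F (g u)) + t * exp (F (g v)) - \<mu> * t * (1 - t) * (norm (g v - g u))\<^sup>2)"

text \<open>The Frechet derivative at \<open>x\<close>, identified with a vector of the Hilbert space. By
  \<open>GDERIV_gradient\<close> below, it is the Riesz representative of the derivative whenever
  \<open>F\<close> is differentiable at \<open>x\<close>; elsewhere its value is unspecified.\<close>

definition gradient :: "('a::real_inner \<Rightarrow> real) \<Rightarrow> 'a \<Rightarrow> 'a" where
  "gradient F x = (THE D. GDERIV F x :> D)"

lemma riesz_representation:
  fixes \<phi> :: "'a::{real_inner, complete_space} \<Rightarrow> real"
  assumes "bounded_linear \<phi>"
  shows "\<exists>D. \<forall>h. \<phi> h = inner h D"
proof -
  interpret bounded_linear \<phi> by fact
  define J where "J x = (norm x)\<^sup>2 / 2 - \<phi> x" for x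
  obtain B where B: "\<And>x. norm (\<phi> x) \<le> norm x * B"
    using bounded by blast
  have low: "- (B\<^sup>2 / 2) \<le> J x" for x
  proof -
    have "\<phi> x \<le> norm x * B" using B[of x] by simp
    moreover have "0 \<le> (norm x - B)\<^sup>2" by simp
    ultimately show ?thesis by (simp add: J_def power2_diff field_simps)
  qed
  define m where "m = (INF x. J x)"
  have bdd: "bdd_below (range J)" using low by (intro bdd_belowI2)
  have m_le: "m \<le> J x" for x unfolding m_def by (rule cINF_lower[OF bdd]) simp
  have "\<exists>x. J x < m + inverse (real (Suc n))" for n
  proof -
    have "Inf (range J) < m + inverse (real (Suc n))" by (simp add: m_def)
    from cInf_lessD[OF _ this] show ?thesis by auto
  qed
  then obtain X where X: "\<And>n. J (X n) < m + inverse (real (Suc n))" by metis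
  have par: "(norm (x - y))\<^sup>2 = 4 * (J x + J y - 2 * J ((1/2) *\<^sub>R (x + y)))" for x y
  proof -
    have "(norm (x - y))\<^sup>2 + (norm (x + y))\<^sup>2 = 2 * (norm x)\<^sup>2 + 2 * (norm y)\<^sup>2"
      by (simp add: power2_norm_eq_inner inner_diff_left inner_diff_right inner_add_left
          inner_add_right inner_commute)
    moreover have "(norm ((1/2) *\<^sub>R (x + y)))\<^sup>2 = (norm (x + y))\<^sup>2 / 4"
      unfolding norm_scaleR power_mult_distrib by (simp add: power2_eq_square)
    moreover have "\<phi> ((1/2) *\<^sub>R (x + y)) = (\<phi> x + \<phi> y) / 2"
      unfolding scaleR add by simp
    ultimately show ?thesis unfolding J_def by argo
  qed
  have "Cauchy X"
  proof (rule metric_CauchyI)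
    fix e :: real assume e: "e > 0"
    obtain N where N: "inverse (real (Suc N)) < e\<^sup>2 / 8"
      using reals_Archimedean[of "e\<^sup>2 / 8"] e by auto
    have small: "J (X n) < m + e\<^sup>2 / 8" if "n \<ge> N" for n
    proof -
      have "inverse (real (Suc n)) \<le> inverse (real (Suc N))" using that by simp
      then show ?thesis using X[of n] N by linarith
    qed
    have "dist (X i) (X j) < e" if "i \<ge> N" "j \<ge> N" for i j
    proof -
      have "(norm (X i - X j))\<^sup>2 < e\<^sup>2"
        using par[of "X i" "X j"] small[OF that(1)] small[OF that(2)]
          m_le[of "(1/2) *\<^sub>R (X i + X j)"] by argo
      then show ?thesis using e by (simp add: dist_norm power2_less_imp_less)
    qed
    then show "\<exists>N. \<forall>i\<ge>N. \<forall>j\<ge>N. dist (X i) (X j) < e" by blast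
  qed
  then obtain D where D: "X \<longlonglongrightarrow> D" using Cauchy_convergent convergent_def by blast
  have "(\<lambda>n. J (X n)) \<longlonglongrightarrow> J D"
    unfolding J_def by (intro tendsto_intros tendsto D) auto
  moreover have "(\<lambda>n. m + inverse (real (Suc n))) \<longlonglongrightarrow> m + 0"
    by (intro tendsto_intros LIMSEQ_inverse_real_of_nat)
  ultimately have "J D \<le> m + 0"
    by (rule LIMSEQ_le) (use X in \<open>auto intro: less_imp_le\<close>)
  then have min: "J D \<le> J x" for x using m_le[of x] by linarith
  have "\<phi> h = inner h D" for h
  proof (cases "h = 0")
    case False
    define c where "c = \<phi> h - inner h D"
    define t where "t = c / (norm h)\<^sup>2"
    have "J (D + t *\<^sub>R h) = J D - t * c + t\<^sup>2 * (norm h)\<^sup>2 / 2"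
    proof -
      have "(norm (D + t *\<^sub>R h))\<^sup>2 = (norm D)\<^sup>2 + 2 * (t * inner h D) + t\<^sup>2 * (norm h)\<^sup>2"
        unfolding power2_norm_eq_inner
        by (simp add: inner_add_left inner_add_right inner_commute[of D h] power2_eq_square distrib_left)
      then show ?thesis
        by (simp add: J_def c_def add scaleR right_diff_distrib add_divide_distrib)
    qed
    also have "\<dots> = J D - c\<^sup>2 / (norm h)\<^sup>2 / 2"
      using False by (simp add: t_def power2_eq_square field_simps)
    finally have "c\<^sup>2 / (norm h)\<^sup>2 \<le> 0" using min[of "D + t *\<^sub>R h"] by simp
    then have "c = 0" using False
      by (metis divide_eq_0_iff norm_eq_zero order_antisym power2_eq_iff_nonneg
          zero_le_divide_iff zero_le_power2 zero_eq_power2)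
    then show ?thesis by (simp add: c_def)
  qed (simp add: zero)
  then show ?thesis by blast
qed

lemma GDERIV_gradient:
  fixes F :: "'a::{real_inner, complete_space} \<Rightarrow> real"
  assumes "F differentiable (at x)"
  shows "GDERIV F x :> gradient F x"
proof -
  obtain F' where F': "(F has_derivative F') (at x)"
    using assms by (auto simp: differentiable_def)
  obtain D where D: "\<And>h. F' h = inner h D"
    using riesz_representation[OF has_derivative_bounded_linear[OF F']] by blast
  then have "GDERIV F x :> D" using F' unfolding gderiv_def
    by (metis (no_types, lifting) ext)
  moreover have "E = D" if "GDERIV F x :> E" for E
  proof -
    have "(\<lambda>h. inner h E) = F'"
      using that F' unfolding gderiv_def by (rule has_derivative_unique)
    then have "inner (E - D) (E - D) = 0"
      using D by (metis diff_self inner_diff_right)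
    then show "E = D" by simp
  qed
  ultimately show ?thesis unfolding gradient_def by (rule theI)
qed

end

theory Submission
  imports Defs
begin

text \<open>Everything happens on a single segment from \<open>x\<close> to \<open>y\<close> and concerns only the function
  \<open>f = exp \<circ> F\<close>, whose gradient is \<open>exp (F x) *\<^sub>R gradient F x\<close> by the chain rule; the two
  conditions are the zeroth and first order characterisations of strong convexity of \<open>f\<close>.

  From zeroth to first order, the strong convexity inequality bounds the difference quotient of \<open>f\<close>
  at \<open>x\<close> in direction \<open>y - x\<close> by \<open>f y - f x - \<mu> * (1 - t) * (norm (y - x))\<^sup>2\<close>, and
  \<open>t\<close> tends to \<open>0\<close> from the right (\<open>first_order_bound_of_strong_convexity\<close>).

  Conversely, the first order bound is used at the intermediate point \<open>z\<close> towards each of the two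
  ends, and the two bounds are averaged with the weights for which the gradient terms cancel
  (\<open>strong_convexity_of_first_order_bound\<close>). Applying the hypothesis at \<open>z\<close> requires that \<open>z\<close> is
  a value of \<open>g\<close> in \<open>K\<close>: this is where general convexity of \<open>K\<close> and surjectivity of \<open>g\<close>
  onto \<open>K\<close> enter.\<close>

text \<open>The gradient gives the one-sided slope of \<open>f\<close> along a ray; every upper bound on the
  difference quotients survives the limit.\<close>

lemma first_order_bound_of_strong_convexity:
  fixes f :: "'a::real_inner \<Rightarrow> real"
  assumes grad: "GDERIV f x :> D"
    and conv: "\<And>t. 0 < t \<Longrightarrow> t < 1 \<Longrightarrow>
      f (x + t *\<^sub>R (y - x))
        \<le> (1 - t) * f x + t * f y - \<mu> * t * (1 - t) * (norm (y - x))\<^sup>2"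
  shows "inner D (y - x) + \<mu> * (norm (y - x))\<^sup>2 \<le> f y - f x"
proof -
  define n where "n = (norm (y - x))\<^sup>2"
  have "((\<lambda>t::real. x + t *\<^sub>R (y - x)) has_derivative (\<lambda>t. t *\<^sub>R (y - x))) (at 0)"
    by (auto intro!: derivative_eq_intros)
  moreover have "(f has_derivative (\<lambda>h. inner h D)) (at (x + 0 *\<^sub>R (y - x)))"
    using grad by (simp add: gderiv_def)
  ultimately have "((\<lambda>t. f (x + t *\<^sub>R (y - x))) has_derivative
      (\<lambda>t. inner (t *\<^sub>R (y - x)) D)) (at 0)"
    by (rule has_derivative_compose)
  then have "DERIV (\<lambda>t. f (x + t *\<^sub>R (y - x))) 0 :> inner D (y - x)"
    unfolding has_field_derivative_def
    by (simp add: inner_commute mult_commute_abs)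
  then have "((\<lambda>t. (f (x + t *\<^sub>R (y - x)) - f x) / t) \<longlongrightarrow> inner D (y - x)) (at 0)"
    by (simp add: DERIV_def)
  then have slope:
    "((\<lambda>t. (f (x + t *\<^sub>R (y - x)) - f x) / t) \<longlongrightarrow> inner D (y - x)) (at_right 0)"
    by (simp add: filterlim_at_split)
  have bound: "((\<lambda>t::real. f y - f x - \<mu> * (1 - t) * n) \<longlongrightarrow> f y - f x - \<mu> * (1 - 0) * n)
      (at_right 0)"
    by (intro tendsto_intros)
  have "\<forall>\<^sub>F t in at_right (0::real).
      (f (x + t *\<^sub>R (y - x)) - f x) / t \<le> f y - f x - \<mu> * (1 - t) * n"
    using eventually_at_right_less[of "0::real"]
      eventually_at_right_real[OF zero_less_one]
  proof eventually_elim
    case (elim t)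
    then have t: "0 < t" "t < 1" by auto
    have "f (x + t *\<^sub>R (y - x)) - f x \<le> (f y - f x - \<mu> * (1 - t) * n) * t"
      using conv[OF t] by (simp add: n_def algebra_simps)
    then show ?case using t by (simp add: divide_le_eq)
  qed
  then have "inner D (y - x) \<le> f y - f x - \<mu> * (1 - 0) * n"
    using tendsto_le[OF _ bound slope] by simp
  then show ?thesis by (simp add: n_def)
qed

text \<open>With \<open>d = y - x\<close>, the ends are seen from \<open>z\<close> in the directions \<open>- t *\<^sub>R d\<close> and
  \<open>(1 - t) *\<^sub>R d\<close>. The weights \<open>1 - t\<close> and \<open>t\<close> cancel the terms linear in \<open>d\<close>, and the
  quadratic terms add up to
  \<open>(1 - t) * t\<^sup>2 + t * (1 - t)\<^sup>2 = t * (1 - t)\<close> times \<open>\<mu> * (norm d)\<^sup>2\<close>.\<close>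

lemma strong_convexity_of_first_order_bound:
  fixes f :: "'a::real_inner \<Rightarrow> real"
  defines "z \<equiv> \<lambda>x y t. x + t *\<^sub>R (y - x)"
  assumes t: "0 \<le> t" "t \<le> 1"
    and to_x: "inner D (x - z x y t) + \<mu> * (norm (x - z x y t))\<^sup>2 \<le> f x - f (z x y t)"
    and to_y: "inner D (y - z x y t) + \<mu> * (norm (y - z x y t))\<^sup>2 \<le> f y - f (z x y t)"
  shows "f (z x y t) \<le> (1 - t) * f x + t * f y - \<mu> * t * (1 - t) * (norm (y - x))\<^sup>2"
proof -
  define n where "n = (norm (y - x))\<^sup>2"
  define s where "s = inner D (y - x)"
  have dx: "x - z x y t = (- t) *\<^sub>R (y - x)" and dy: "y - z x y t = (1 - t) *\<^sub>R (y - x)"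
    by (simp_all add: z_def algebra_simps)
  have "- t * s + \<mu> * (t\<^sup>2 * n) \<le> f x - f (z x y t)"
    using to_x unfolding dx norm_scaleR power_mult_distrib inner_scaleR_right
    by (simp add: n_def s_def)
  moreover have "(1 - t) * s + \<mu> * ((1 - t)\<^sup>2 * n) \<le> f y - f (z x y t)"
    using to_y unfolding dy norm_scaleR power_mult_distrib inner_scaleR_right
    by (simp add: n_def s_def)
  ultimately have
    "(1 - t) * (- t * s + \<mu> * (t\<^sup>2 * n)) + t * ((1 - t) * s + \<mu> * ((1 - t)\<^sup>2 * n))
      \<le> (1 - t) * (f x - f (z x y t)) + t * (f y - f (z x y t))"
    using t by (intro add_mono mult_left_mono) auto
  then show ?thesis
    unfolding n_def[symmetric] by (simp add: algebra_simps power2_eq_square)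
qed

theorem theorem29:
  fixes g :: "'a::{real_inner, complete_space} \<Rightarrow> 'a"
    and K :: "'a set"
    and F :: "'a \<Rightarrow> real"
    and \<mu> :: real
  assumes "general_convex g K"
    and "K \<subseteq> range g"
    and "\<mu> > 0"
    and "\<And>x. x \<in> K \<Longrightarrow> F x > 0"
    and "\<And>x. x \<in> K \<Longrightarrow> F differentiable (at x)"
  shows "strongly_exp_general_convex \<mu> g K F \<longleftrightarrow>
    (\<forall>u v. g u \<in> K \<longrightarrow> g v \<in> K \<longrightarrow>
       exp (F (g v)) - exp (F (g u))
         \<ge> inner (exp (F (g u)) *\<^sub>R gradient F (g u)) (g v - g u) + \<mu> * (norm (g v - g u))\<^sup>2)"
    (is "?convex \<longleftrightarrow> ?first_order")
proof
  assume conv: ?convex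
  show ?first_order
  proof (intro allI impI)
    fix u v assume uv: "g u \<in> K" "g v \<in> K"
    have "GDERIV (\<lambda>x. exp (F x)) (g u) :> exp (F (g u)) *\<^sub>R gradient F (g u)"
      by (rule GDERIV_DERIV_compose[OF GDERIV_gradient[OF assms(5)[OF uv(1)]] DERIV_exp])
    then show "inner (exp (F (g u)) *\<^sub>R gradient F (g u)) (g v - g u) + \<mu> * (norm (g v - g u))\<^sup>2
        \<le> exp (F (g v)) - exp (F (g u))"
      by (rule first_order_bound_of_strong_convexity)
        (use conv uv in \<open>simp add: strongly_exp_general_convex_def\<close>)
  qed
next
  assume first_order: ?first_order
  show ?convex
    unfolding strongly_exp_general_convex_def
  proof (intro allI ballI impI)
    fix u v and t :: real
    assume t: "t \<in> {0..1}" and uv: "g u \<in> K" "g v \<in> K"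
    have zK: "g u + t *\<^sub>R (g v - g u) \<in> K"
      using assms(1) t uv by (simp add: general_convex_def)
    then obtain w where w: "g u + t *\<^sub>R (g v - g u) = g w"
      using assms(2) by blast
    have wK: "g w \<in> K"
      using zK w by simp
    show "exp (F (g u + t *\<^sub>R (g v - g u)))
        \<le> (1 - t) * exp (F (g u)) + t * exp (F (g v)) - \<mu> * t * (1 - t) * (norm (g v - g u))\<^sup>2"
    proof (rule strong_convexity_of_first_order_bound[where f = "\<lambda>x. exp (F x)"
          and D = "exp (F (g w)) *\<^sub>R gradient F (g w)"])
      show "0 \<le> t" "t \<le> 1" using t by auto
    qed (unfold w; use first_order wK uv in blast)+
  qed
qed

end
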